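(* Let $a>1$, $\lambda>0$, $\gamma>1$, $\theta>1$ be such that $|\vec\delta^\theta|\ge a^{-1}$. Let $x\in L^{2a}(\mathcal F_0;\mathbb R^d)$ be independent of $\{\xi^H_n\}_{n\ge0}$. Let $b(n,x)$ and $\sigma(n,x)$ (possibly depending on $\omega$) be measurable functions on $\mathcal T\times\mathbb R^d$ with values in $\mathbb R^d$ and $\mathbb R^{d\times m}$ respectively, such that: (i) for every $x\in\mathbb R^d$, $b(\cdot,x)$ and $\sigma(\cdot,x)$ are adapted processes belonging to $L^{2a,\vec\delta^\theta,\lambda,\gamma}_{\mathcal F}(0,+\infty)$; (ii) there is a constant $L>0$ such that for all $n\in\mathcal T$ and $x_1,x_2\in\mathbb R^d$, $$\|x_1+b(n,x_1)-x_2-b(n,x_2)\|+\|\sigma(n,x_1)-\sigma(n,x_2)\|\le L\|x_1-x_2\|.$$ Then the stochastic difference equation $$X_{n+1}=X_n+b(n,X_n)+\sigma(n,X_n)\xi^H_n,\quad n\ge 0,\qquad X_0=x,$$ has a unique solution in $L^{2a,\vec\delta^\theta,\lambda,\gamma}_{\mathcal F}(0,+\infty)$.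
   Context: $\mathcal T=\{0,1,2,\dots\}$. $H\in(0,1)$; $B^H$ is an $m$-dimensional fractional Brownian motion with Hurst parameter $H$ on a probability space $(\Omega,\mathcal F,P)$, and $\xi^H_n=B^H(n+1)-B^H(n)$, $n\ge0$. $\mathcal F_0\subset\mathcal F$ is a sub-$\sigma$-algebra and $\mathcal F_n=\mathcal F_0\vee\sigma(\xi^H_0,\dots,\xi^H_{n-1})$ for $n\ge 0$. "Adapted" means $X_n$ is $\mathcal F_n$-measurable for every $n$. $L^\beta(\mathcal F_n;\mathbb R^d)$ is the set of $\mathcal F_n$-measurable $\mathbb R^d$-valued random variables $X$ with $\mathbb E\|X\|^\beta<+\infty$. For a sequence $\vec\delta=(\delta_1,\delta_2,\dots)$ with $\delta_n\in(0,1)$ put $|\vec\delta|=\lim_{n\to\infty}\prod_{i=1}^n\delta_i$ (required to be $>0$). $L^{\beta,\vec\delta,\lambda,\gamma}_{\mathcal F}(0,+\infty)$ is the set of adapted processes $X=(X_n)_{n\ge0}$ (vector- or matrix-valued) with $$\sum_{n=0}^{\infty}e^{-\lambda n^\gamma}\,\mathbb E\big(\|X_n\|^{\beta\delta_1\cdots\delta_n}\big)<+\infty$$ (for $n=0$ the exponent is $\beta$). For $\theta>1$, $\vec\delta^\theta$ denotes the sequence $\delta_n=1-(n+2)^{-\theta}$, $n\ge1$. *)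

theory Defs
  imports "HOL-Probability.Probability"
begin

text \<open>Gaussian random variables; a degenerate one (variance zero) is almost surely constant and
  has no density.\<close>

definition gaussian_rv :: "'w measure \<Rightarrow> ('w \<Rightarrow> real) \<Rightarrow> bool" where
  "gaussian_rv M Z \<longleftrightarrow> Z \<in> borel_measurable M \<and>
     ((\<exists>\<mu>. AE \<omega> in M. Z \<omega> = \<mu>) \<or>
      (\<exists>\<mu> s. s > 0 \<and> distributed M lborel Z (\<lambda>z. ennreal (normal_density \<mu> s z))))"

text \<open>A process on the time set \<open>T\<close> is Gaussian if every finite linear combination of its
  coordinates, over finitely many times, is Gaussian.\<close>

definition gaussian_process ::
  "'w measure \<Rightarrow> real set \<Rightarrow> (real \<Rightarrow> 'w \<Rightarrow> real ^ 'm) \<Rightarrow> bool" where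
  "gaussian_process M T B \<longleftrightarrow>
     (\<forall>t\<in>T. B t \<in> borel_measurable M) \<and>
     (\<forall>I c. finite I \<and> I \<subseteq> T \<longrightarrow> gaussian_rv M (\<lambda>\<omega>. \<Sum>t\<in>I. c t \<bullet> B t \<omega>))"

text \<open>Fractional Brownian motion: centred Gaussian with independent coordinates, each having the
  covariance below. Continuity of the sample paths is not demanded.\<close>

definition fbm_cov :: "real \<Rightarrow> real \<Rightarrow> real \<Rightarrow> real" where
  "fbm_cov H s t = (s powr (2 * H) + t powr (2 * H) - \<bar>t - s\<bar> powr (2 * H)) / 2"

definition fractional_brownian_motion ::
  "'w measure \<Rightarrow> real \<Rightarrow> (real \<Rightarrow> 'w \<Rightarrow> real ^ 'm) \<Rightarrow> bool" where
  "fractional_brownian_motion M H B \<longleftrightarrow>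
     gaussian_process M {0..} B \<and>
     (\<forall>t\<ge>0. \<forall>i. (\<integral>\<omega>. B t \<omega> $ i \<partial>M) = 0) \<and>
     (\<forall>s\<ge>0. \<forall>t\<ge>0. \<forall>i j.
        (\<integral>\<omega>. B s \<omega> $ i * B t \<omega> $ j \<partial>M) = (if i = j then fbm_cov H s t else 0))"

definition fractional_noise :: "(real \<Rightarrow> 'w \<Rightarrow> real ^ 'm) \<Rightarrow> nat \<Rightarrow> 'w \<Rightarrow> real ^ 'm" where
  "fractional_noise B n \<omega> = B (real n + 1) \<omega> - B (real n) \<omega>"

definition noise_filtration ::
  "'w measure \<Rightarrow> 'w measure \<Rightarrow> (nat \<Rightarrow> 'w \<Rightarrow> real ^ 'm) \<Rightarrow> nat \<Rightarrow> 'w measure" where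
  "noise_filtration M F0 \<xi> n =
     sigma (space M) (sets F0 \<union> (\<Union>k<n. sets (vimage_algebra (space M) (\<xi> k) borel)))"

text \<open>Independence of a random variable and a sequence, i.e. of the generated
  \<open>\<sigma>\<close>-algebras (the value types differ, so \<open>indep_var\<close> does not apply).\<close>

definition indep_of_sequence ::
  "'w measure \<Rightarrow> ('w \<Rightarrow> real ^ 'd) \<Rightarrow> (nat \<Rightarrow> 'w \<Rightarrow> real ^ 'm) \<Rightarrow> bool" where
  "indep_of_sequence M x \<xi> \<longleftrightarrow>
     prob_space.indep_set M
       (sets (vimage_algebra (space M) x borel))
       (sigma_sets (space M) (\<Union>k. sets (vimage_algebra (space M) (\<xi> k) borel)))"

definition Lp_rv :: "'w measure \<Rightarrow> 'w measure \<Rightarrow> real \<Rightarrow> ('w \<Rightarrow> 'b::real_normed_vector) set" where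
  "Lp_rv M G \<beta> = {X. X \<in> borel_measurable G \<and> (\<integral>\<^sup>+\<omega>. ennreal (norm (X \<omega>) powr \<beta>) \<partial>M) < \<infinity>}"

text \<open>Sequences \<open>\<delta>\<close> are indexed from 1; the value at 0 is never used.\<close>

definition delta_limit :: "(nat \<Rightarrow> real) \<Rightarrow> real" where
  "delta_limit \<delta> = lim (\<lambda>n. \<Prod>i=1..n. \<delta> i)"

definition delta_theta :: "real \<Rightarrow> nat \<Rightarrow> real" where
  "delta_theta \<theta> n = 1 - (real n + 2) powr (-\<theta>)"

definition adapted_process ::
  "(nat \<Rightarrow> 'w measure) \<Rightarrow> (nat \<Rightarrow> 'w \<Rightarrow> 'b::real_normed_vector) \<Rightarrow> bool" where
  "adapted_process F X \<longleftrightarrow> (\<forall>n. X n \<in> borel_measurable (F n))"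

definition weighted_L ::
  "'w measure \<Rightarrow> (nat \<Rightarrow> 'w measure) \<Rightarrow> real \<Rightarrow> (nat \<Rightarrow> real) \<Rightarrow> real \<Rightarrow> real
     \<Rightarrow> (nat \<Rightarrow> 'w \<Rightarrow> 'b::real_normed_vector) set" where
  "weighted_L M F \<beta> \<delta> l \<gamma> = {X. adapted_process F X \<and>
     (\<Sum>n. ennreal (exp (- l * real n powr \<gamma>)) *
        (\<integral>\<^sup>+\<omega>. ennreal (norm (X n \<omega>) powr (\<beta> * (\<Prod>i=1..n. \<delta> i))) \<partial>M)) < \<infinity>}"

definition sde_solution ::
  "'w measure \<Rightarrow> ('w \<Rightarrow> real ^ 'd) \<Rightarrow> (nat \<Rightarrow> real ^ 'd \<Rightarrow> 'w \<Rightarrow> real ^ 'd)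
     \<Rightarrow> (nat \<Rightarrow> real ^ 'd \<Rightarrow> 'w \<Rightarrow> real ^ 'm ^ 'd) \<Rightarrow> (nat \<Rightarrow> 'w \<Rightarrow> real ^ 'm)
     \<Rightarrow> (nat \<Rightarrow> 'w \<Rightarrow> real ^ 'd) \<Rightarrow> bool" where
  "sde_solution M x b \<sigma> \<xi> X \<longleftrightarrow>
     (AE \<omega> in M. X 0 \<omega> = x \<omega>) \<and>
     (\<forall>n. AE \<omega> in M. X (Suc n) \<omega> = X n \<omega> + b n (X n \<omega>) \<omega> + \<sigma> n (X n \<omega>) \<omega> *v \<xi> n \<omega>)"

end

theory Submission
  imports Defs "HOL-Real_Asymp.Real_Asymp"
begin

text \<open>Put \<open>p n = 2 * a * \<delta> 1 * \<dots> * \<delta> n\<close>. By the Lipschitz condition the norm of \<open>X (n + 1)\<close> is at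
  most \<open>1 + \<close> the norm of the noise, times an affine function of the norm of \<open>X n\<close>. Passing from the
  exponent \<open>p n\<close> to \<open>p n * \<delta> (n + 1)\<close> leaves room for Hoelder's inequality, at the price of
  a moment of the Gaussian noise of order about \<open>(n + 3) powr \<theta>\<close>; as the noise is stationary with
  finite exponential moments, this costs only a factor \<open>\<kappa> n\<close> of polynomial growth. The weights
  decrease by the factor \<open>exp (- l * n powr (\<gamma> - 1))\<close>, which beats \<open>\<kappa> n\<close> because \<open>\<gamma> > 1\<close>, so the
  weighted moments are summable. Uniqueness is an induction on time.\<close>

section \<open>Matrix-vector products\<close>

text \<open>Cauchy-Schwarz in each row; the norm of a matrix here is the L2 norm of its row norms,
  so the constant is 1.\<close>

lemma norm_matrix_vector_mult_le:
  fixes A :: "real ^ 'm ^ 'd"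
  shows "norm (A *v v) \<le> norm A * norm v"
proof -
  have "norm (A *v v) \<le> L2_set (\<lambda>i. norm (A $ i) * norm v) UNIV"
    unfolding norm_vec_def[of "A *v v"]
    by (intro L2_set_mono) (auto simp: matrix_vector_mul_component Cauchy_Schwarz_ineq2)
  also have "\<dots> = norm A * norm v"
    by (simp add: norm_vec_def[of A] L2_set_left_distrib[symmetric])
  finally show ?thesis .
qed

text \<open>Gives joint continuity of the product, hence measurability of the diffusion
  term.\<close>

lemma bounded_bilinear_matrix_vector_mult:
  "bounded_bilinear ((*v) :: real ^ 'm ^ 'd \<Rightarrow> real ^ 'm \<Rightarrow> real ^ 'd)"
proof
  show "\<exists>K. \<forall>(A :: real ^ 'm ^ 'd) v. norm (A *v v) \<le> norm A * norm v * K"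
    by (intro exI[of _ 1]) (simp add: norm_matrix_vector_mult_le)
qed (simp_all add: matrix_vector_mult_add_rdistrib matrix_vector_right_distrib
      scaleR_matrix_vector_assoc matrix_vector_mult_scaleR)

section \<open>Summability from a contracting recursion\<close>

text \<open>From some \<open>N\<close> on the factor is at most \<open>1/2\<close>, so twice the new
  term is paid for by the old term and \<open>c n\<close>. The terms before \<open>N\<close> only
  have to be finite, which follows by induction from \<open>T 0\<close>.\<close>

lemma ennreal_summable_recursion:
  fixes T c :: "nat \<Rightarrow> ennreal" and \<rho> :: "nat \<Rightarrow> real"
  assumes step: "\<And>n. T (Suc n) \<le> ennreal (\<rho> n) * (T n + c n)"
    and \<rho>: "\<rho> \<longlonglongrightarrow> 0" and T0: "T 0 < \<infinity>" and c: "(\<Sum>n. c n) < \<infinity>"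
  shows "(\<Sum>n. T n) < \<infinity>"
proof -
  have cn: "c n < \<infinity>" for n
    using c ennreal_suminf_lessD by blast
  have Tn: "T n < \<infinity>" for n
  proof (induction n)
    case (Suc n)
    then show ?case
      using cn[of n] step[of n] by (auto simp: ennreal_mult_less_top intro: le_less_trans)
  qed (use T0 in auto)
  have "eventually (\<lambda>n. \<rho> n < 1/2) sequentially"
    using \<rho> by (rule order_tendstoD) auto
  then obtain N where N: "\<And>n. n \<ge> N \<Longrightarrow> \<rho> n \<le> 1/2"
    by (meson eventually_sequentially less_imp_le)
  \<comment> \<open>Once \<open>\<rho> n \<le> 1/2\<close>, the potential \<open>V\<close> grows by at most \<open>c n\<close>.\<close>
  define V where "V n = (\<Sum>k<n. T k) + 2 * T n" for n
  have V_step: "V (Suc n) \<le> V n + c n" if "n \<ge> N" for n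
  proof -
    have "T (Suc n) \<le> ennreal (1/2) * (T n + c n)"
      using step[of n] N[OF that] by (meson ennreal_leI mult_right_mono order_trans zero_le)
    then have "2 * T (Suc n) \<le> 2 * (ennreal (1/2) * (T n + c n))"
      by (intro mult_left_mono) auto
    also have "\<dots> = T n + c n"
    proof -
      have "2 * ennreal (1/2) = 1"
        by (subst ennreal_numeral[symmetric], subst ennreal_mult[symmetric]) auto
      then show ?thesis by (simp only: mult.assoc[symmetric] mult_1)
    qed
    finally show ?thesis
      unfolding V_def by (simp add: mult_2 add.assoc add_left_mono)
  qed
  have V_le: "V n \<le> V N + (\<Sum>k<n. c k)" if "n \<ge> N" for n
    using that
  proof (induction n rule: dec_induct)
    case (step n)
    have "V (Suc n) \<le> V n + c n" using V_step step by simp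
    also have "\<dots> \<le> V N + (\<Sum>k<n. c k) + c n" using step by (intro add_mono) auto
    finally show ?case by (simp add: add.assoc)
  qed simp
  have "(\<Sum>k<n. T k) \<le> V N + (\<Sum>k. c k)" for n
  proof -
    have "(\<Sum>k<n. T k) \<le> (\<Sum>k<max n N. T k)" by (intro sum_mono2) auto
    also have "\<dots> \<le> V (max n N)" by (simp add: V_def)
    also have "\<dots> \<le> V N + (\<Sum>k<max n N. c k)" by (rule V_le) simp
    also have "\<dots> \<le> V N + (\<Sum>k. c k)" by (intro add_left_mono sum_le_suminf) auto
    finally show ?thesis .
  qed
  then have "(\<Sum>n. T n) \<le> V N + (\<Sum>k. c k)"
    by (intro suminf_le_const) auto
  also have "\<dots> < \<infinity>"
    using c Tn by (auto simp: V_def ennreal_mult_less_top)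
  finally show ?thesis .
qed

section \<open>Gaussian variables and moments of the noise\<close>

text \<open>Completing the square turns \<open>exp (c * z)\<close> times a normal density into a
  constant times the normal density with mean moved by \<open>c * s\<^sup>2\<close>, whose mass is
  1. An almost surely constant variable has variance 0 and fits the same formula.\<close>

lemma (in prob_space) nn_integral_exp_gaussian_rv:
  assumes "gaussian_rv M Z"
  shows "(\<integral>\<^sup>+\<omega>. ennreal (exp (c * Z \<omega>)) \<partial>M) =
    ennreal (exp (c * expectation Z + c\<^sup>2 * variance Z / 2))"
proof -
  have [measurable]: "Z \<in> borel_measurable M"
    using assms by (simp add: gaussian_rv_def)
  consider \<mu> where "AE \<omega> in M. Z \<omega> = \<mu>"
    | \<mu> s where "s > 0" "distributed M lborel Z (\<lambda>z. ennreal (normal_density \<mu> s z))"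
    using assms by (auto simp: gaussian_rv_def)
  then show ?thesis
  proof cases
    case 1
    have E: "expectation Z = (\<integral>\<omega>. \<mu> \<partial>M)"
      by (rule integral_cong_AE) (use 1 in auto)
    have "variance Z = (\<integral>\<omega>. 0 \<partial>M)"
      by (rule integral_cong_AE) (use 1 E in \<open>auto simp: prob_space\<close>)
    moreover have "(\<integral>\<^sup>+\<omega>. ennreal (exp (c * Z \<omega>)) \<partial>M) = (\<integral>\<^sup>+\<omega>. ennreal (exp (c * \<mu>)) \<partial>M)"
      by (rule nn_integral_cong_AE) (use 1 in auto)
    ultimately show ?thesis
      using E by (simp add: prob_space emeasure_space_1)
  next
    case 2
    have shift: "normal_density \<mu> s z * exp (c * z) =
      exp (c * \<mu> + c\<^sup>2 * s\<^sup>2 / 2) * normal_density (\<mu> + c * s\<^sup>2) s z" for z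
    proof -
      have "- (z - \<mu>)\<^sup>2 / (2 * s\<^sup>2) + c * z =
        c * \<mu> + c\<^sup>2 * s\<^sup>2 / 2 + - (z - (\<mu> + c * s\<^sup>2))\<^sup>2 / (2 * s\<^sup>2)"
        using 2 by (simp add: field_simps power2_eq_square)
      then show ?thesis
        by (simp add: normal_density_def exp_add[symmetric])
    qed
    have "(\<integral>\<^sup>+\<omega>. ennreal (exp (c * Z \<omega>)) \<partial>M) =
        (\<integral>\<^sup>+z. ennreal (normal_density \<mu> s z) * ennreal (exp (c * z)) \<partial>lborel)"
      by (rule distributed_nn_integral[OF 2(2), symmetric]) simp
    also have "\<dots> = (\<integral>\<^sup>+z. ennreal (exp (c * \<mu> + c\<^sup>2 * s\<^sup>2 / 2)) *
        ennreal (normal_density (\<mu> + c * s\<^sup>2) s z) \<partial>lborel)"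
      by (simp add: shift normal_density_nonneg flip: ennreal_mult)
    also have "\<dots> = ennreal (exp (c * \<mu> + c\<^sup>2 * s\<^sup>2 / 2))"
      using 2 by (simp add: nn_integral_cmult nn_integral_eq_integral normal_density_nonneg)
    finally show ?thesis
      using normal_distributed_expectation[OF 2] normal_distributed_variance[OF 2] by simp
  qed
qed

text \<open>The integral of a non-integrable function is 0 by default, so the mean and covariance
  identities of fractional Brownian motion can be expanded linearly only once integrability is
  known.\<close>

lemma (in prob_space) gaussian_rv_integrable:
  assumes "gaussian_rv M Z"
  shows "integrable M Z" and "integrable M (\<lambda>\<omega>. (Z \<omega>)\<^sup>2)"
proof -
  have [measurable]: "Z \<in> borel_measurable M"
    using assms by (simp add: gaussian_rv_def)
  have "integrable M Z \<and> integrable M (\<lambda>\<omega>. (Z \<omega>)\<^sup>2)"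
    using assms[unfolded gaussian_rv_def]
  proof (elim conjE disjE exE)
    fix \<mu> assume *: "AE \<omega> in M. Z \<omega> = \<mu>"
    show ?thesis
      by (intro conjI; subst integrable_cong_AE[where g = "\<lambda>_. _"])
        (use * in auto)
  next
    fix \<mu> s :: real
    assume s: "s > 0" and D: "distributed M lborel Z (\<lambda>z. ennreal (normal_density \<mu> s z))"
    have int: "integrable lborel (\<lambda>z. normal_density \<mu> s z * g z) \<longleftrightarrow> integrable M (\<lambda>\<omega>. g (Z \<omega>))"
      if "g \<in> borel_measurable lborel" for g :: "real \<Rightarrow> real"
      by (rule distributed_integrable[OF D that]) (simp add: normal_density_nonneg)
    have 1: "integrable M Z"
      using int[of "\<lambda>z. z"] integrable_normal_moment_nz_1[OF s] by simp
    have "integrable M (\<lambda>\<omega>. (Z \<omega> - \<mu>)\<^sup>2)"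
      using int[of "\<lambda>z. (z - \<mu>)\<^sup>2"] integrable_normal_moment[OF s, of \<mu> 2] by simp
    \<comment> \<open>Expanded, this integrand is \<open>(Z \<omega>)\<^sup>2\<close>.\<close>
    then have "integrable M (\<lambda>\<omega>. (Z \<omega> - \<mu>)\<^sup>2 + 2 * \<mu> * Z \<omega> - \<mu>\<^sup>2)"
      using 1 by simp
    then show ?thesis
      using 1 by (simp add: power2_eq_square algebra_simps)
  qed
  then show "integrable M Z" "integrable M (\<lambda>\<omega>. (Z \<omega>)\<^sup>2)" by auto
qed

lemma (in prob_space)
  assumes B: "fractional_brownian_motion M H B"
  shows gaussian_rv_fbm: "t \<ge> 0 \<Longrightarrow> gaussian_rv M (\<lambda>\<omega>. B t \<omega> $ i)"
    and gaussian_rv_fractional_noise: "gaussian_rv M (\<lambda>\<omega>. fractional_noise B n \<omega> $ i)"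
proof -
  have lin: "gaussian_rv M (\<lambda>\<omega>. \<Sum>t\<in>I. c t \<bullet> B t \<omega>)" if "finite I" "I \<subseteq> {0..}" for I c
    using B that by (auto simp: fractional_brownian_motion_def gaussian_process_def)
  show "gaussian_rv M (\<lambda>\<omega>. B t \<omega> $ i)" if "t \<ge> 0"
    using lin[of "{t}" "\<lambda>_. axis i 1"] that by (simp add: inner_axis')
  show "gaussian_rv M (\<lambda>\<omega>. fractional_noise B n \<omega> $ i)"
    using lin[of "{real n, real n + 1}" "\<lambda>t. if t = real n then - axis i 1 else axis i 1"]
    by (simp add: inner_axis' fractional_noise_def)
qed

text \<open>In the variance of the increment the powers of \<open>n\<close> and \<open>n + 1\<close>
  cancel, leaving \<open>1 powr (2 * H)\<close>. Being Gaussian, each coordinate of the noise thus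
  has the same law at all times.\<close>

lemma (in prob_space)
  assumes B: "fractional_brownian_motion M H B"
  shows expectation_fractional_noise: "expectation (\<lambda>\<omega>. fractional_noise B n \<omega> $ i) = 0"
    and variance_fractional_noise: "variance (\<lambda>\<omega>. fractional_noise B n \<omega> $ i) = 1"
proof -
  define U where "U \<omega> = B (real n + 1) \<omega> $ i" for \<omega>
  define V where "V \<omega> = B (real n) \<omega> $ i" for \<omega>
  have g: "gaussian_rv M U" "gaussian_rv M V"
    unfolding U_def V_def by (intro gaussian_rv_fbm[OF B]; simp)+
  note int = gaussian_rv_integrable[OF g(1)] gaussian_rv_integrable[OF g(2)]
  have noise: "fractional_noise B n \<omega> $ i = U \<omega> - V \<omega>" for \<omega>
    by (simp add: fractional_noise_def U_def V_def)
  have mean: "expectation U = 0" "expectation V = 0"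
    using B unfolding U_def V_def by (auto simp: fractional_brownian_motion_def)
  show E: "expectation (\<lambda>\<omega>. fractional_noise B n \<omega> $ i) = 0"
    using int mean by (simp add: noise)
  have cov: "(\<integral>\<omega>. B s \<omega> $ i * B t \<omega> $ i \<partial>M) = fbm_cov H s t" if "s \<ge> 0" "t \<ge> 0" for s t
    using B that by (auto simp: fractional_brownian_motion_def)
  have sq: "integrable M (\<lambda>\<omega>. (U \<omega> - V \<omega>)\<^sup>2)"
    using gaussian_rv_integrable(2)[OF gaussian_rv_fractional_noise[OF B, of n i]]
    by (simp add: noise)
  \<comment> \<open>Polarization: the integrand is \<open>U \<omega> * V \<omega>\<close>, and
    \<open>U - V\<close> is square integrable as a Gaussian variable.\<close>
  have "integrable M (\<lambda>\<omega>. ((U \<omega>)\<^sup>2 + (V \<omega>)\<^sup>2 - (U \<omega> - V \<omega>)\<^sup>2) / 2)"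
    using int sq by simp
  then have UV: "integrable M (\<lambda>\<omega>. U \<omega> * V \<omega>)"
    by (simp add: power2_diff)
  have "variance (\<lambda>\<omega>. fractional_noise B n \<omega> $ i) = (\<integral>\<omega>. (U \<omega>)\<^sup>2 + (V \<omega>)\<^sup>2 - 2 * (U \<omega> * V \<omega>) \<partial>M)"
    by (simp add: E) (simp add: noise power2_diff mult.assoc)
  also have "\<dots> = fbm_cov H (real n + 1) (real n + 1) + fbm_cov H (real n) (real n)
      - 2 * fbm_cov H (real n + 1) (real n)"
    using int UV cov[of "real n + 1" "real n + 1"] cov[of "real n" "real n"]
      cov[of "real n + 1" "real n"]
    by (simp add: U_def V_def power2_eq_square)
  also have "\<dots> = 1"
    by (simp add: fbm_cov_def field_simps)
  finally show "variance (\<lambda>\<omega>. fractional_noise B n \<omega> $ i) = 1" .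
qed

text \<open>The norm is at most \<open>m\<close> times the largest modulus of a coordinate, so
  one-dimensional exponential moments at \<open>m\<close> and \<open>- m\<close> suffice. They are
  uniform in \<open>n\<close>, the coordinates having mean 0 and variance 1 at all times.\<close>

lemma (in prob_space) nn_integral_exp_norm_fractional_noise_le:
  fixes B :: "real \<Rightarrow> 'a \<Rightarrow> real ^ 'm"
  assumes B: "fractional_brownian_motion M H B"
  shows "(\<integral>\<^sup>+\<omega>. ennreal (exp (norm (fractional_noise B n \<omega>))) \<partial>M)
    \<le> ennreal (2 * real CARD('m) * exp ((real CARD('m))\<^sup>2 / 2))"
proof -
  define m where "m = real CARD('m)"
  define Z where "Z i \<omega> = fractional_noise B n \<omega> $ i" for i \<omega>
  have g: "gaussian_rv M (Z i)" for i
    unfolding Z_def by (rule gaussian_rv_fractional_noise[OF B])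
  have [measurable]: "Z i \<in> borel_measurable M" for i
    using g by (auto simp: gaussian_rv_def)
  have mgf: "(\<integral>\<^sup>+\<omega>. ennreal (exp (c * Z i \<omega>)) \<partial>M) = ennreal (exp (c\<^sup>2 / 2))" for c i
    using nn_integral_exp_gaussian_rv[OF g, of c i]
      expectation_fractional_noise[OF B, of n i]
      variance_fractional_noise[OF B, of n i]
    by (simp add: Z_def[abs_def])
  have "exp (norm (fractional_noise B n \<omega>)) \<le> (\<Sum>i\<in>UNIV. exp (m * Z i \<omega>) + exp (- m * Z i \<omega>))"
    for \<omega>
  proof -
    \<comment> \<open>The coordinate of largest modulus, found as a minimiser of the negated
      moduli.\<close>
    obtain j where j: "\<And>i. \<bar>Z i \<omega>\<bar> \<le> \<bar>Z j \<omega>\<bar>"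
      using ex_is_arg_min_if_finite[of UNIV "\<lambda>i. - \<bar>Z i \<omega>\<bar>"]
      by (auto simp: is_arg_min_def not_less)
    have "norm (fractional_noise B n \<omega>) \<le> (\<Sum>i\<in>(UNIV :: 'm set). \<bar>Z i \<omega>\<bar>)"
      unfolding Z_def by (rule norm_le_l1_cart)
    also have "\<dots> \<le> m * \<bar>Z j \<omega>\<bar>"
      unfolding m_def using sum_bounded_above[of UNIV "\<lambda>i. \<bar>Z i \<omega>\<bar>" "\<bar>Z j \<omega>\<bar>"] j by simp
    finally have "exp (norm (fractional_noise B n \<omega>)) \<le> exp (m * \<bar>Z j \<omega>\<bar>)" by simp
    also have "\<dots> \<le> exp (m * Z j \<omega>) + exp (- m * Z j \<omega>)"
      by (cases "Z j \<omega> \<ge> 0") auto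
    \<comment> \<open>\<open>j\<close> depends on \<open>\<omega>\<close>; summing over all
      coordinates removes it before integration.\<close>
    also have "\<dots> \<le> (\<Sum>i\<in>UNIV. exp (m * Z i \<omega>) + exp (- m * Z i \<omega>))"
      by (rule member_le_sum) auto
    finally show ?thesis .
  qed
  then have "(\<integral>\<^sup>+\<omega>. ennreal (exp (norm (fractional_noise B n \<omega>))) \<partial>M)
      \<le> (\<integral>\<^sup>+\<omega>. (\<Sum>i\<in>UNIV. ennreal (exp (m * Z i \<omega>)) + ennreal (exp (- m * Z i \<omega>))) \<partial>M)"
    by (intro nn_integral_mono) (simp add: ennreal_leI sum_ennreal add_nonneg_nonneg flip: ennreal_plus)
  also have "\<dots> = (\<Sum>i\<in>(UNIV :: 'm set). ennreal (exp (m\<^sup>2 / 2)) + ennreal (exp (m\<^sup>2 / 2)))"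
    using mgf[of "- m"] by (subst nn_integral_sum) (auto simp: nn_integral_add mgf)
  also have "\<dots> = ennreal (2 * m * exp (m\<^sup>2 / 2))"
    by (simp add: m_def ennreal_of_nat_eq_real_of_nat mult.commute flip: ennreal_plus ennreal_mult)
  finally show ?thesis by (simp add: m_def)
qed

section \<open>One-step moment estimates\<close>

text \<open>The two factors of \<open>(1 + v) * w\<close> are separated by Young's inequality in the crude form
  \<open>z powr (1 - \<delta>) * W powr \<delta> \<le> max z W\<close>; scaling \<open>1 + v\<close> by \<open>q\<close> turns its high power
  into an exponential, since \<open>(t / q) powr q \<le> exp t\<close>.\<close>

lemma powr_young_exp_le:
  fixes y w v p \<delta> :: real
  assumes y: "0 \<le> y" "y \<le> (1 + v) * w" and wv: "0 \<le> w" "0 \<le> v"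
    and p: "0 < p" "0 < \<delta>" "\<delta> < 1"
  defines "q \<equiv> p * \<delta> / (1 - \<delta>)"
  shows "y powr (p * \<delta>) \<le> q powr (p * \<delta>) * (w powr p + exp (1 + v))"
proof -
  have q: "q > 0" using assms by (simp add: q_def)
  \<comment> \<open>This identity dictates \<open>q\<close>:
    \<open>((1 + v) / q) powr (p * \<delta>)\<close> becomes \<open>z powr (1 - \<delta>)\<close>,
    the partner of \<open>(w powr p) powr \<delta>\<close>.\<close>
  have r: "p * \<delta> = q * (1 - \<delta>)" using assms by (simp add: q_def)
  define z where "z = ((1 + v) / q) powr q"
  define m where "m = max z (w powr p)"
  have "(1 + v) / q \<le> exp ((1 + v) / q)"
    using exp_ge_add_one_self[of "(1 + v) / q"] by linarith
  then have "z \<le> exp ((1 + v) / q) powr q"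
    unfolding z_def using \<open>0 \<le> v\<close> q by (intro powr_mono2) auto
  also have "\<dots> = exp (1 + v)" using q by (simp add: powr_def)
  finally have z: "z \<le> exp (1 + v)" .
  have m0: "0 \<le> m" by (simp add: m_def le_max_iff_disj)
  have "y powr (p * \<delta>) \<le> (q * ((1 + v) / q) * w) powr (p * \<delta>)"
    using y p q by (intro powr_mono2) auto
  also have "\<dots> = q powr (p * \<delta>) * (((1 + v) / q) powr (p * \<delta>) * w powr (p * \<delta>))"
    using wv q by (simp only: powr_mult mult.assoc)
  also have "((1 + v) / q) powr (p * \<delta>) = z powr (1 - \<delta>)"
    unfolding r z_def by (simp only: powr_powr)
  also have "w powr (p * \<delta>) = (w powr p) powr \<delta>"
    by (simp only: powr_powr)
  also have "q powr (p * \<delta>) * (z powr (1 - \<delta>) * (w powr p) powr \<delta>)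
      \<le> q powr (p * \<delta>) * (m powr (1 - \<delta>) * m powr \<delta>)"
    using p by (intro mult_left_mono mult_mono powr_mono2) (auto simp: m_def z_def)
  also have "m powr (1 - \<delta>) * m powr \<delta> = m"
    using m0 by (simp flip: powr_add)
  also have "m \<le> w powr p + exp (1 + v)"
    using z by (auto simp: m_def intro: add_increasing add_increasing2)
  finally show ?thesis by (simp add: mult_left_mono)
qed

text \<open>The left side is compared with the maximum of \<open>x\<close>, \<open>y\<close>,
  \<open>u\<close>, whose power is one of the terms on the right. The exponent \<open>P\<close> on
  the constant serves all \<open>p \<le> P\<close> at once, as the base is at least 1.\<close>

lemma powr_sum3_le:
  fixes x y u k p P :: real
  assumes "0 \<le> x" "0 \<le> y" "0 \<le> u" "0 \<le> k" "0 < p" "p \<le> P"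
  shows "(x + y + k * u) powr p \<le> (3 * (1 + k)) powr P * (x powr p + y powr p + u powr p)"
proof -
  define m where "m = max x (max y u)"
  have m: "x \<le> m" "y \<le> m" "u \<le> m" "0 \<le> m" using assms by (auto simp: m_def)
  have "k * u \<le> k * m" using m assms by (intro mult_left_mono)
  moreover have "0 \<le> k * m" using m assms by simp
  ultimately have "x + y + k * u \<le> 3 * (1 + k) * m"
    using m by (simp add: algebra_simps)
  then have "(x + y + k * u) powr p \<le> (3 * (1 + k) * m) powr p"
    using assms by (intro powr_mono2) auto
  also have "\<dots> = (3 * (1 + k)) powr p * m powr p"
    using assms m by (simp add: powr_mult)
  also have "\<dots> \<le> (3 * (1 + k)) powr P * (x powr p + y powr p + u powr p)"
    using assms by (intro mult_mono powr_mono) (auto simp: m_def max_def)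
  finally show ?thesis .
qed

text \<open>Lowering the exponent from \<open>p\<close> to \<open>p * \<delta>\<close> lets a
  pointwise bound turn the product of state and noise into a sum, so that the two are integrated
  separately whatever their correlation. The factor depends only on the uniform bounds
  \<open>P\<close>, \<open>Q\<close>, \<open>k\<close> and \<open>E\<close>.\<close>

lemma (in prob_space) nn_integral_affine_growth_step:
  fixes f u \<beta> s v :: "'a \<Rightarrow> real"
  assumes [measurable]: "f \<in> borel_measurable M" "u \<in> borel_measurable M" "\<beta> \<in> borel_measurable M"
      "s \<in> borel_measurable M" "v \<in> borel_measurable M"
    and nonneg: "\<And>\<omega>. 0 \<le> f \<omega>" "\<And>\<omega>. 0 \<le> u \<omega>" "\<And>\<omega>. 0 \<le> \<beta> \<omega>" "\<And>\<omega>. 0 \<le> s \<omega>" "\<And>\<omega>. 0 \<le> v \<omega>"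
    and growth: "AE \<omega> in M. f \<omega> \<le> (1 + v \<omega>) * (\<beta> \<omega> + s \<omega> + k * u \<omega>)"
    and v: "(\<integral>\<^sup>+\<omega>. ennreal (exp (v \<omega>)) \<partial>M) \<le> ennreal E" "0 \<le> E"
    and "0 \<le> k" and p: "0 < p" "p \<le> P" and \<delta>: "0 < \<delta>" "\<delta> < 1"
    and Q: "1 \<le> Q" "p * \<delta> / (1 - \<delta>) \<le> Q"
  shows "(\<integral>\<^sup>+\<omega>. ennreal (f \<omega> powr (p * \<delta>)) \<partial>M)
    \<le> ennreal (Q powr P * ((3 * (1 + k)) powr P + exp 1 * E)) *
      ((\<integral>\<^sup>+\<omega>. ennreal (u \<omega> powr p) \<partial>M) +
       ((\<integral>\<^sup>+\<omega>. ennreal (\<beta> \<omega> powr p) \<partial>M) + (\<integral>\<^sup>+\<omega>. ennreal (s \<omega> powr p) \<partial>M) + 1))"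
proof -
  define q where "q = p * \<delta> / (1 - \<delta>)"
  define D where "D = (3 * (1 + k)) powr P"
  define K where "K = D + exp 1 * E"
  have D: "0 \<le> D" and K: "0 \<le> K" using v by (simp_all add: D_def K_def)
  have "0 \<le> q" using p \<delta> by (simp add: q_def)
  \<comment> \<open>First the base grows to \<open>Q\<close>, then the exponent to \<open>P\<close>;
    the latter needs \<open>Q \<ge> 1\<close>.\<close>
  have "q powr (p * \<delta>) \<le> Q powr (p * \<delta>)"
    using p \<delta> Q \<open>0 \<le> q\<close> by (intro powr_mono2) (auto simp: q_def)
  also have "p * \<delta> \<le> P"
    using p \<delta> mult_left_mono[of \<delta> 1 p] by linarith
  then have "Q powr (p * \<delta>) \<le> Q powr P"
    using Q by (intro powr_mono)
  finally have qQ: "q powr (p * \<delta>) \<le> Q powr P" .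
  have "(\<integral>\<^sup>+\<omega>. ennreal (f \<omega> powr (p * \<delta>)) \<partial>M) \<le> (\<integral>\<^sup>+\<omega>. ennreal (Q powr P) *
     (ennreal D * (ennreal (\<beta> \<omega> powr p) + ennreal (s \<omega> powr p) + ennreal (u \<omega> powr p))
       + ennreal (exp 1) * ennreal (exp (v \<omega>))) \<partial>M)"
  proof (rule nn_integral_mono_AE, use growth in eventually_elim)
    case (elim \<omega>)
    have "f \<omega> powr (p * \<delta>) \<le> q powr (p * \<delta>) * ((\<beta> \<omega> + s \<omega> + k * u \<omega>) powr p + exp (1 + v \<omega>))"
      unfolding q_def using elim nonneg p \<delta> \<open>0 \<le> k\<close> by (intro powr_young_exp_le) auto
    also have "\<dots> \<le> Q powr P * (D * (\<beta> \<omega> powr p + s \<omega> powr p + u \<omega> powr p) + exp 1 * exp (v \<omega>))"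
      unfolding D_def exp_add using nonneg p \<open>0 \<le> k\<close>
      by (intro mult_mono qQ add_mono powr_sum3_le) auto
    finally show ?case
      using D by (simp flip: ennreal_plus ennreal_mult)
  qed
  also have "\<dots> = ennreal (Q powr P) * (ennreal D * ((\<integral>\<^sup>+\<omega>. ennreal (\<beta> \<omega> powr p) \<partial>M)
     + (\<integral>\<^sup>+\<omega>. ennreal (s \<omega> powr p) \<partial>M) + (\<integral>\<^sup>+\<omega>. ennreal (u \<omega> powr p) \<partial>M))
       + ennreal (exp 1) * (\<integral>\<^sup>+\<omega>. ennreal (exp (v \<omega>)) \<partial>M))"
    by (simp add: nn_integral_cmult nn_integral_add)
  also have "\<dots> \<le> ennreal (Q powr P) * (ennreal D * ((\<integral>\<^sup>+\<omega>. ennreal (\<beta> \<omega> powr p) \<partial>M)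
     + (\<integral>\<^sup>+\<omega>. ennreal (s \<omega> powr p) \<partial>M) + (\<integral>\<^sup>+\<omega>. ennreal (u \<omega> powr p) \<partial>M))
       + ennreal (exp 1) * ennreal E)"
    using v by (intro mult_left_mono add_left_mono) auto
  \<comment> \<open>\<open>K\<close> dominates both \<open>D\<close> and \<open>exp 1 * E\<close>,
    so it can be factored out; the noise leaves the summand 1.\<close>
  also have "\<dots> \<le> ennreal (Q powr P) * (ennreal K * ((\<integral>\<^sup>+\<omega>. ennreal (\<beta> \<omega> powr p) \<partial>M)
     + (\<integral>\<^sup>+\<omega>. ennreal (s \<omega> powr p) \<partial>M) + (\<integral>\<^sup>+\<omega>. ennreal (u \<omega> powr p) \<partial>M))
       + ennreal K)"
    using D v by (intro mult_left_mono add_mono mult_right_mono)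
      (auto simp: K_def simp flip: ennreal_mult intro!: ennreal_leI)
  also have "\<dots> = ennreal (Q powr P * K) *
      ((\<integral>\<^sup>+\<omega>. ennreal (u \<omega> powr p) \<partial>M) +
       ((\<integral>\<^sup>+\<omega>. ennreal (\<beta> \<omega> powr p) \<partial>M) + (\<integral>\<^sup>+\<omega>. ennreal (s \<omega> powr p) \<partial>M) + 1))"
    using K by (simp add: ennreal_mult distrib_left add_ac mult.assoc)
  finally show ?thesis unfolding D_def K_def .
qed

section \<open>Measurable composition with random continuous functions\<close>

text \<open>Continuity holds only almost surely, so \<open>h (Z \<omega>) \<omega>\<close> itself need not be measurable on the
  exceptional null set; the limit along simple approximations of \<open>Z\<close> is a measurable version.\<close>

lemma measurable_random_continuous_compose:
  fixes h :: "'a :: {metric_space, second_countable_topology} \<Rightarrow> 'w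
      \<Rightarrow> 'b :: {banach, second_countable_topology}"
  assumes h: "\<And>y. h y \<in> borel_measurable G" and Z: "Z \<in> borel_measurable G"
    and "space G = space M" and cont: "AE \<omega> in M. continuous_on UNIV (\<lambda>y. h y \<omega>)"
  shows "\<exists>W \<in> borel_measurable G. AE \<omega> in M. W \<omega> = h (Z \<omega>) \<omega>"
proof -
  obtain S where S: "\<And>i. simple_function G (S i)"
    and lim: "\<And>\<omega>. \<omega> \<in> space G \<Longrightarrow> (\<lambda>i. S i \<omega>) \<longlonglongrightarrow> Z \<omega>"
    using borel_measurable_implies_sequence_metric[OF Z] by metis
  \<comment> \<open>A simple function has finitely many values, so only finitely many of the
    functions \<open>h y\<close> occur.\<close>
  have [measurable]: "(\<lambda>\<omega>. h (S i \<omega>) \<omega>) \<in> borel_measurable G" for i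
  proof (rule measurable_compose_countable'[where I = "S i ` space G"])
    show "S i \<in> G \<rightarrow>\<^sub>M count_space (S i ` space G)"
      using S[of i] by (intro measurable_count_space_eq2[THEN iffD2]) (auto simp: simple_function_def)
    show "countable (S i ` space G)"
      using S[of i] by (auto simp: simple_function_def countable_finite)
  qed (rule h)
  have "AE \<omega> in M. lim (\<lambda>i. h (S i \<omega>) \<omega>) = h (Z \<omega>) \<omega>"
    using cont AE_space
  proof eventually_elim
    case (elim \<omega>)
    have "(\<lambda>i. h (S i \<omega>) \<omega>) \<longlonglongrightarrow> h (Z \<omega>) \<omega>"
      using elim lim[of \<omega>] assms(3)
      by (intro continuous_on_tendsto_compose[OF elim(1)]) auto
    then show ?case by (rule limI)
  qed
  \<comment> \<open>Where the sequence diverges, \<open>lim\<close> is a fixed default value, so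
    this version is measurable in \<open>G\<close> even if the exceptional null set does not lie in
    \<open>G\<close>.\<close>
  then show ?thesis by (intro bexI[of _ "\<lambda>\<omega>. lim (\<lambda>i. h (S i \<omega>) \<omega>)"]) auto
qed

section \<open>The filtration generated by the noise\<close>

lemma
  assumes F0: "subalgebra M F0" and \<xi>: "\<And>k. \<xi> k \<in> borel_measurable M"
  shows sets_noise_filtration: "sets (noise_filtration M F0 \<xi> n) = sigma_sets (space M)
      (sets F0 \<union> (\<Union>k<n. sets (vimage_algebra (space M) (\<xi> k) borel)))"
    and subalgebra_noise_filtration: "subalgebra M (noise_filtration M F0 \<xi> n)"
proof -
  let ?A = "sets F0 \<union> (\<Union>k<n. sets (vimage_algebra (space M) (\<xi> k) borel))"
  have "sets (vimage_algebra (space M) (\<xi> k) borel) \<subseteq> sets M" for k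
    using measurable_sets[OF \<xi>] by (auto simp: sets_vimage_algebra2)
  then have A: "?A \<subseteq> sets M"
    using F0 by (auto simp: subalgebra_def)
  then show *: "sets (noise_filtration M F0 \<xi> n) = sigma_sets (space M) ?A"
    unfolding noise_filtration_def
    using sets.space_closed[of M] by (intro sets_measure_of) auto
  show "subalgebra M (noise_filtration M F0 \<xi> n)"
    unfolding subalgebra_def * using sets.sigma_sets_subset[OF A]
    by (simp add: noise_filtration_def space_measure_of_conv)
qed

lemma
  fixes \<xi> :: "nat \<Rightarrow> 'w \<Rightarrow> real ^ 'm"
  assumes F0: "subalgebra M F0" and \<xi>: "\<And>k. \<xi> k \<in> borel_measurable M"
  shows borel_measurable_noise_filtration_F0:
      "f \<in> borel_measurable F0 \<Longrightarrow> f \<in> borel_measurable (noise_filtration M F0 \<xi> n)"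
    and borel_measurable_noise_filtration_mono:
      "n \<le> n' \<Longrightarrow> f \<in> borel_measurable (noise_filtration M F0 \<xi> n)
        \<Longrightarrow> f \<in> borel_measurable (noise_filtration M F0 \<xi> n')"
    and borel_measurable_noise_filtration_noise:
      "k < n \<Longrightarrow> \<xi> k \<in> borel_measurable (noise_filtration M F0 \<xi> n)"
proof -
  note sets = sets_noise_filtration[of M F0 \<xi>, OF F0 \<xi>]
  have sp: "space (noise_filtration M F0 \<xi> n) = space M" for n
    by (simp add: noise_filtration_def space_measure_of_conv)
  show "f \<in> borel_measurable F0 \<Longrightarrow> f \<in> borel_measurable (noise_filtration M F0 \<xi> n)"
    by (rule measurable_from_subalg[rotated])
      (use F0 in \<open>auto simp: subalgebra_def sp sets intro: sigma_sets.Basic\<close>)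
  show "f \<in> borel_measurable (noise_filtration M F0 \<xi> n)
      \<Longrightarrow> f \<in> borel_measurable (noise_filtration M F0 \<xi> n')" if "n \<le> n'"
  proof -
    have "sets (noise_filtration M F0 \<xi> n) \<subseteq> sets (noise_filtration M F0 \<xi> n')"
      unfolding sets using that by (intro sigma_sets_mono' Un_mono UN_mono order_refl) auto
    then have "subalgebra (noise_filtration M F0 \<xi> n') (noise_filtration M F0 \<xi> n)"
      by (simp add: subalgebra_def sp)
    then show "f \<in> borel_measurable (noise_filtration M F0 \<xi> n)
      \<Longrightarrow> f \<in> borel_measurable (noise_filtration M F0 \<xi> n')"
      by (rule measurable_from_subalg)
  qed
  show "\<xi> k \<in> borel_measurable (noise_filtration M F0 \<xi> n)" if "k < n"
  proof (rule measurableI)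
    fix A :: "(real ^ 'm) set" assume "A \<in> sets borel"
    then have "\<xi> k -` A \<inter> space M \<in> sets (vimage_algebra (space M) (\<xi> k) borel)"
      by (rule in_vimage_algebra)
    then show "\<xi> k -` A \<inter> space (noise_filtration M F0 \<xi> n) \<in> sets (noise_filtration M F0 \<xi> n)"
      unfolding sp sets using that by (intro sigma_sets.Basic) auto
  qed auto
qed

section \<open>Exponent gaps and weights\<close>

text \<open>The gap to 1 is the denominator of the Hoelder exponent, so its reciprocal
  \<open>(real n + 3) powr \<theta>\<close> sets the growth of the constants.\<close>

lemma delta_theta_Suc:
  assumes "\<theta> > 0"
  shows "0 < delta_theta \<theta> (Suc n)" "delta_theta \<theta> (Suc n) < 1"
    "1 - delta_theta \<theta> (Suc n) = (real n + 3) powr (- \<theta>)"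
proof -
  have "(real n + 3) powr (- \<theta>) < (real n + 3) powr 0"
    using assms by (intro powr_less_mono) auto
  then show "0 < delta_theta \<theta> (Suc n)" "delta_theta \<theta> (Suc n) < 1"
    "1 - delta_theta \<theta> (Suc n) = (real n + 3) powr (- \<theta>)"
    by (auto simp: delta_theta_def add_ac)
qed

text \<open>Split \<open>(n + 1) powr \<gamma>\<close> as
  \<open>(n + 1) * (n + 1) powr (\<gamma> - 1)\<close> and shrink the second factor to
  \<open>n powr (\<gamma> - 1)\<close>; what remains is
  \<open>n powr \<gamma> + n powr (\<gamma> - 1)\<close>. The case \<open>n = 0\<close> rests on the
  convention that powers of 0 are 0.\<close>

lemma exp_weight_Suc_le:
  assumes "l > 0" "\<gamma> > 1"
  shows "exp (- l * real (Suc n) powr \<gamma>)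
    \<le> exp (- l * real n powr (\<gamma> - 1)) * exp (- l * real n powr \<gamma>)"
proof -
  have *: "x * x powr (\<gamma> - 1) = x powr \<gamma>" if "x \<ge> 0" for x :: real
    using that by (cases "x = 0") (simp_all add: powr_mult_base)
  have "real n powr (\<gamma> - 1) + real n powr \<gamma> = real (Suc n) * real n powr (\<gamma> - 1)"
    using *[of "real n"] by (simp add: algebra_simps)
  also have "\<dots> \<le> real (Suc n) * real (Suc n) powr (\<gamma> - 1)"
    using assms by (intro mult_left_mono powr_mono2) auto
  also have "\<dots> = real (Suc n) powr \<gamma>"
    by (rule *) simp
  finally have "l * (real n powr (\<gamma> - 1) + real n powr \<gamma>) \<le> l * real (Suc n) powr \<gamma>"
    using assms by (intro mult_left_mono) auto
  then show ?thesis by (simp add: algebra_simps flip: exp_add)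
qed

text \<open>Handles the summand 1 of the moment estimate, which contributes the bare weights. As
  \<open>n powr \<gamma> \<ge> n\<close> for \<open>n \<ge> 1\<close>, a geometric series
  dominates.\<close>

lemma suminf_exp_weight_finite:
  assumes "l > 0" "\<gamma> > 1"
  shows "(\<Sum>n. ennreal (exp (- l * real n powr \<gamma>))) < \<infinity>"
proof -
  have "summable (\<lambda>n. exp (- l * real n powr \<gamma>))"
  proof (rule summable_comparison_test')
    show "summable (\<lambda>n. exp (- l) ^ n)" using assms by (intro summable_geometric) auto
    show "norm (exp (- l * real n powr \<gamma>)) \<le> exp (- l) ^ n" if "n \<ge> 1" for n
    proof -
      have "real n powr 1 \<le> real n powr \<gamma>" using that assms by (intro powr_mono) auto
      then show ?thesis using assms that by (simp add: mult.commute flip: exp_of_nat_mult)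
    qed
  qed
  then show ?thesis by (simp add: suminf_ennreal2)
qed

theorem theorem2:
  fixes M F0 :: "'w measure"
    and B :: "real \<Rightarrow> 'w \<Rightarrow> real ^ 'm"
    and x :: "'w \<Rightarrow> real ^ 'd"
    and b :: "nat \<Rightarrow> real ^ 'd \<Rightarrow> 'w \<Rightarrow> real ^ 'd"
    and \<sigma> :: "nat \<Rightarrow> real ^ 'd \<Rightarrow> 'w \<Rightarrow> real ^ 'm ^ 'd"
    and H a l \<gamma> \<theta> L :: real
  defines "\<xi> \<equiv> fractional_noise B"
  defines "F \<equiv> noise_filtration M F0 \<xi>"
  assumes "prob_space M"
    and "0 < H" and "H < 1"
    and "fractional_brownian_motion M H B"
    and "subalgebra M F0"
    and "a > 1" and "l > 0" and "\<gamma> > 1" and "\<theta> > 1"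
    and "delta_limit (delta_theta \<theta>) \<ge> 1 / a"
    and "x \<in> Lp_rv M F0 (2 * a)"
    and "indep_of_sequence M x \<xi>"
    and "\<And>\<omega>. \<omega> \<in> space M \<Longrightarrow> (\<lambda>(n, y). b n y \<omega>) \<in> borel_measurable (count_space UNIV \<Otimes>\<^sub>M borel)"
    and "\<And>\<omega>. \<omega> \<in> space M \<Longrightarrow> (\<lambda>(n, y). \<sigma> n y \<omega>) \<in> borel_measurable (count_space UNIV \<Otimes>\<^sub>M borel)"
    and "\<And>y. (\<lambda>n. b n y) \<in> weighted_L M F (2 * a) (delta_theta \<theta>) l \<gamma>"
    and "\<And>y. (\<lambda>n. \<sigma> n y) \<in> weighted_L M F (2 * a) (delta_theta \<theta>) l \<gamma>"
    and "L > 0"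
    and "AE \<omega> in M. \<forall>n y z.
           norm (y + b n y \<omega> - z - b n z \<omega>) + norm (\<sigma> n y \<omega> - \<sigma> n z \<omega>) \<le> L * norm (y - z)"
  shows "\<exists>X. X \<in> weighted_L M F (2 * a) (delta_theta \<theta>) l \<gamma> \<and> sde_solution M x b \<sigma> \<xi> X \<and>
           (\<forall>Y. Y \<in> weighted_L M F (2 * a) (delta_theta \<theta>) l \<gamma> \<and> sde_solution M x b \<sigma> \<xi> Y
              \<longrightarrow> (AE \<omega> in M. \<forall>n. Y n \<omega> = X n \<omega>))"
proof -
  interpret prob_space M by fact
  note fbm = \<open>fractional_brownian_motion M H B\<close>
  note lip = assms(20)
  have "B t \<in> borel_measurable M" if "t \<ge> 0" for t
    using fbm that by (auto simp: fractional_brownian_motion_def gaussian_process_def)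
  then have \<xi>_M [measurable]: "\<xi> n \<in> borel_measurable M" for n
    unfolding \<xi>_def fractional_noise_def[abs_def] by (intro borel_measurable_diff) auto
  note filt = \<open>subalgebra M F0\<close> \<xi>_M
  have subF: "subalgebra M (F n)" for n
    unfolding F_def by (rule subalgebra_noise_filtration[OF filt])
  then have spF: "space (F n) = space M" for n
    by (simp add: subalgebra_def)
  have F_Suc: "f \<in> borel_measurable (F n) \<Longrightarrow> f \<in> borel_measurable (F (Suc n))"
    for n and f :: "'w \<Rightarrow> 'z :: topological_space"
    unfolding F_def by (rule borel_measurable_noise_filtration_mono[OF filt, of n]) auto
  \<comment> \<open>\<open>F n\<close> is built from the noise at times below \<open>n\<close>, so
    \<open>\<xi> n\<close> enters one step later.\<close>
  have \<xi>_F: "\<xi> n \<in> borel_measurable (F (Suc n))" for n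
    unfolding F_def by (rule borel_measurable_noise_filtration_noise[OF filt]) auto
  have b_F: "b n y \<in> borel_measurable (F n)" and \<sigma>_F: "\<sigma> n y \<in> borel_measurable (F n)" for n y
    using assms(17,18)[of y] by (auto simp: weighted_L_def adapted_process_def)

  \<comment> \<open>Construction of an adapted solution\<close>
  have step: "\<exists>W \<in> borel_measurable (F (Suc n)).
      AE \<omega> in M. W \<omega> = Z \<omega> + b n (Z \<omega>) \<omega> + \<sigma> n (Z \<omega>) \<omega> *v \<xi> n \<omega>"
    if Z: "Z \<in> borel_measurable (F n)" for n Z
  proof -
    \<comment> \<open>The Lipschitz condition controls \<open>y + b n y \<omega>\<close> as a whole,
      so state and drift are composed together.\<close>
    have "AE \<omega> in M. continuous_on UNIV (\<lambda>y. y + b n y \<omega>) \<and> continuous_on UNIV (\<lambda>y. \<sigma> n y \<omega>)"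
      using lip
    proof eventually_elim
      case (elim \<omega>)
      have "norm (y + b n y \<omega> - (z + b n z \<omega>)) \<le> L * norm (y - z)"
        "norm (\<sigma> n y \<omega> - \<sigma> n z \<omega>) \<le> L * norm (y - z)" for y z
        using elim[rule_format, of y n z] norm_ge_zero[of "y + b n y \<omega> - (z + b n z \<omega>)"]
          norm_ge_zero[of "\<sigma> n y \<omega> - \<sigma> n z \<omega>"]
        unfolding diff_diff_eq by linarith+
      then have "L-lipschitz_on UNIV (\<lambda>y. y + b n y \<omega>)" "L-lipschitz_on UNIV (\<lambda>y. \<sigma> n y \<omega>)"
        using \<open>L > 0\<close> by (auto intro!: lipschitz_onI simp: dist_norm)
      then show ?case by (auto intro: lipschitz_on_continuous_on)
    qed
    then have cont: "AE \<omega> in M. continuous_on UNIV (\<lambda>y. y + b n y \<omega>)"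
      "AE \<omega> in M. continuous_on UNIV (\<lambda>y. \<sigma> n y \<omega>)" by auto
    have "(\<lambda>\<omega>. y + b n y \<omega>) \<in> borel_measurable (F n)" for y
      using b_F by (intro borel_measurable_add) auto
    from measurable_random_continuous_compose[OF this Z spF cont(1)]
    obtain U where U: "U \<in> borel_measurable (F n)" "AE \<omega> in M. U \<omega> = Z \<omega> + b n (Z \<omega>) \<omega>"
      by auto
    from measurable_random_continuous_compose[OF \<sigma>_F Z spF cont(2)]
    obtain V where V: "V \<in> borel_measurable (F n)" "AE \<omega> in M. V \<omega> = \<sigma> n (Z \<omega>) \<omega>"
      by auto
    have "(\<lambda>\<omega>. U \<omega> + V \<omega> *v \<xi> n \<omega>) \<in> borel_measurable (F (Suc n))"
    proof (intro borel_measurable_add F_Suc[OF U(1)])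
      show "(\<lambda>\<omega>. V \<omega> *v \<xi> n \<omega>) \<in> borel_measurable (F (Suc n))"
        by (rule borel_measurable_continuous_Pair[OF F_Suc[OF V(1)] \<xi>_F])
          (intro bounded_bilinear.continuous_on[OF bounded_bilinear_matrix_vector_mult] continuous_intros)
    qed
    moreover have "AE \<omega> in M. U \<omega> + V \<omega> *v \<xi> n \<omega> =
        Z \<omega> + b n (Z \<omega>) \<omega> + \<sigma> n (Z \<omega>) \<omega> *v \<xi> n \<omega>"
      using U(2) V(2) by eventually_elim simp
    ultimately show ?thesis by (intro bexI[where x = "\<lambda>\<omega>. U \<omega> + V \<omega> *v \<xi> n \<omega>"])
  qed
  have x: "x \<in> borel_measurable F0" "(\<integral>\<^sup>+\<omega>. ennreal (norm (x \<omega>) powr (2 * a)) \<partial>M) < \<infinity>"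
    using \<open>x \<in> Lp_rv M F0 (2 * a)\<close> by (auto simp: Lp_rv_def)
  \<comment> \<open>Dependent choice among almost sure versions of the next state; the clause for
    \<open>n = 0\<close> pins the initial value.\<close>
  have "\<exists>X. \<forall>n. (X n \<in> borel_measurable (F n) \<and> (n = 0 \<longrightarrow> X n = x)) \<and>
      (AE \<omega> in M. X (Suc n) \<omega> = X n \<omega> + b n (X n \<omega>) \<omega> + \<sigma> n (X n \<omega>) \<omega> *v \<xi> n \<omega>)"
  proof (rule dependent_nat_choice)
    show "\<exists>Z. Z \<in> borel_measurable (F 0) \<and> ((0::nat) = 0 \<longrightarrow> Z = x)"
      unfolding F_def using borel_measurable_noise_filtration_F0[OF filt x(1)] by auto
  next
    fix Z n assume "Z \<in> borel_measurable (F n) \<and> (n = 0 \<longrightarrow> Z = x)"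
    with step[of Z n] show "\<exists>W. (W \<in> borel_measurable (F (Suc n)) \<and> (Suc n = 0 \<longrightarrow> W = x)) \<and>
      (AE \<omega> in M. W \<omega> = Z \<omega> + b n (Z \<omega>) \<omega> + \<sigma> n (Z \<omega>) \<omega> *v \<xi> n \<omega>)" by auto
  qed
  then obtain X where X_F: "\<And>n. X n \<in> borel_measurable (F n)" and X0: "X 0 = x"
    and X_Suc: "\<And>n. AE \<omega> in M. X (Suc n) \<omega> = X n \<omega> + b n (X n \<omega>) \<omega> + \<sigma> n (X n \<omega>) \<omega> *v \<xi> n \<omega>"
    by blast

  \<comment> \<open>Exponents and constants of the recursion\<close>
  define \<delta> where "\<delta> n = delta_theta \<theta> (Suc n)" for n
  define p where "p n = 2 * a * (\<Prod>i=1..n. delta_theta \<theta> i)" for n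
  note \<delta> = delta_theta_Suc[of \<theta>, folded \<delta>_def]
  have \<delta>01: "0 < \<delta> n" "\<delta> n < 1" "1 - \<delta> n = (real n + 3) powr (- \<theta>)" for n
    using \<delta>[of n] \<open>\<theta> > 1\<close> by auto
  have p_Suc: "p (Suc n) = p n * \<delta> n" for n
    by (simp add: p_def \<delta>_def)
  have p0: "p 0 = 2 * a" by (simp add: p_def)
  have p: "0 < p n \<and> p n \<le> 2 * a" for n
  proof (induction n)
    case (Suc n)
    then have "p n * \<delta> n \<le> p n * 1" using \<delta>01[of n] by (intro mult_left_mono) auto
    then have "p (Suc n) \<le> 2 * a" using Suc p_Suc[of n] by linarith
    with Suc show ?case using \<delta>01[of n] by (simp add: p_Suc)
  qed (use \<open>a > 1\<close> p0 in auto)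

  define w where "w n = exp (- l * real n powr \<gamma>)" for n
  define A where "A n = (\<integral>\<^sup>+\<omega>. ennreal (norm (X n \<omega>) powr p n) \<partial>M)" for n
  define \<beta> where "\<beta> n = (\<integral>\<^sup>+\<omega>. ennreal (norm (b n 0 \<omega>) powr p n) \<partial>M)" for n
  define s where "s n = (\<integral>\<^sup>+\<omega>. ennreal (norm (\<sigma> n 0 \<omega>) powr p n) \<partial>M)" for n
  \<comment> \<open>\<open>E\<close> bounds the exponential moment of the noise;
    \<open>\<kappa> n\<close> is the factor of \<open>nn_integral_affine_growth_step\<close> for
    \<open>P = 2 * a\<close>, \<open>k = 2 * L\<close> and
    \<open>Q = 2 * a * (real n + 3) powr \<theta>\<close>.\<close>
  define E where "E = 2 * real CARD('m) * exp ((real CARD('m))\<^sup>2 / 2)"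
  define C where "C = (3 * (1 + 2 * L)) powr (2 * a) + exp 1 * E"
  define \<kappa> where "\<kappa> n = (2 * a * (real n + 3) powr \<theta>) powr (2 * a) * C" for n
  have "E > 0" by (simp add: E_def)
  then have "C > 0" by (simp add: C_def add_nonneg_pos)

  \<comment> \<open>Growth of the moments\<close>
  have growth: "AE \<omega> in M. norm (X (Suc n) \<omega>)
      \<le> (1 + norm (\<xi> n \<omega>)) * (norm (b n 0 \<omega>) + norm (\<sigma> n 0 \<omega>) + 2 * L * norm (X n \<omega>))" for n
    using lip X_Suc[of n]
  proof eventually_elim
    case (elim \<omega>)
    let ?u = "norm (X n \<omega>)" and ?v = "norm (\<xi> n \<omega>)"
      and ?W = "norm (b n 0 \<omega>) + norm (\<sigma> n 0 \<omega>) + 2 * L * norm (X n \<omega>)"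
    \<comment> \<open>Comparison with the state 0 bounds both the drift part and the matrix by
      \<open>?W\<close>, so the noise contributes the factor \<open>1 + ?v\<close>.\<close>
    have l: "norm (X n \<omega> + b n (X n \<omega>) \<omega> - b n 0 \<omega>) + norm (\<sigma> n (X n \<omega>) \<omega> - \<sigma> n 0 \<omega>) \<le> L * ?u"
      using elim(1)[rule_format, of "X n \<omega>" n 0] by simp
    have "0 \<le> L * ?u" using \<open>L > 0\<close> by simp
    have "norm (X n \<omega> + b n (X n \<omega>) \<omega>) \<le> norm (X n \<omega> + b n (X n \<omega>) \<omega> - b n 0 \<omega>) + norm (b n 0 \<omega>)"
      by (metis diff_add_cancel norm_triangle_ineq)
    then have 1: "norm (X n \<omega> + b n (X n \<omega>) \<omega>) \<le> ?W"
      using l \<open>0 \<le> L * ?u\<close> norm_ge_zero[of "\<sigma> n (X n \<omega>) \<omega> - \<sigma> n 0 \<omega>"] norm_ge_zero[of "\<sigma> n 0 \<omega>"]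
      by linarith
    have "norm (\<sigma> n (X n \<omega>) \<omega>) \<le> norm (\<sigma> n (X n \<omega>) \<omega> - \<sigma> n 0 \<omega>) + norm (\<sigma> n 0 \<omega>)"
      by (metis diff_add_cancel norm_triangle_ineq)
    then have 2: "norm (\<sigma> n (X n \<omega>) \<omega>) \<le> ?W"
      using l \<open>0 \<le> L * ?u\<close> norm_ge_zero[of "X n \<omega> + b n (X n \<omega>) \<omega> - b n 0 \<omega>"]
        norm_ge_zero[of "b n 0 \<omega>"]
      by linarith
    have "norm (X (Suc n) \<omega>) \<le> norm (X n \<omega> + b n (X n \<omega>) \<omega>) + norm (\<sigma> n (X n \<omega>) \<omega> *v \<xi> n \<omega>)"
      unfolding elim by (rule norm_triangle_ineq)
    also have "norm (\<sigma> n (X n \<omega>) \<omega> *v \<xi> n \<omega>) \<le> norm (\<sigma> n (X n \<omega>) \<omega>) * ?v"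
      by (rule norm_matrix_vector_mult_le)
    also have "\<dots> \<le> ?W * ?v" using 2 by (intro mult_right_mono) auto
    also note 1
    finally show ?case by (simp add: algebra_simps)
  qed

  have moment: "A (Suc n) \<le> ennreal (\<kappa> n) * (A n + (\<beta> n + s n + 1))" for n
  proof -
    \<comment> \<open>Division by \<open>1 - \<delta> n\<close> is multiplication by
      \<open>(real n + 3) powr \<theta>\<close>, so the Hoelder exponent stays below the
      \<open>Q\<close> built into \<open>\<kappa>\<close>.\<close>
    have "p n * \<delta> n \<le> 2 * a * 1"
      using p[of n] \<delta>01[of n] \<open>a > 1\<close> by (intro mult_mono) auto
    then have "p n * \<delta> n * (real n + 3) powr \<theta> \<le> 2 * a * (real n + 3) powr \<theta>"
      by (intro mult_right_mono) auto
    then have q: "p n * \<delta> n / (1 - \<delta> n) \<le> 2 * a * (real n + 3) powr \<theta>"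
      unfolding \<delta>01(3) by (simp add: powr_minus field_simps)
    have "1 * 1 \<le> 2 * a * (real n + 3) powr \<theta>"
      using \<open>a > 1\<close> \<open>\<theta> > 1\<close> by (intro mult_mono ge_one_powr_ge_zero) auto
    then have Q: "1 \<le> 2 * a * (real n + 3) powr \<theta>" by simp
    have [measurable]: "X k \<in> borel_measurable M" "b n 0 \<in> borel_measurable M"
      "\<sigma> n 0 \<in> borel_measurable M" for k
      using measurable_from_subalg[OF subF] X_F b_F \<sigma>_F by blast+
    show ?thesis
      unfolding A_def \<beta>_def s_def \<kappa>_def C_def p_Suc
    proof (rule nn_integral_affine_growth_step[where v = "\<lambda>\<omega>. norm (\<xi> n \<omega>)"])
      show "(\<integral>\<^sup>+\<omega>. ennreal (exp (norm (\<xi> n \<omega>))) \<partial>M) \<le> ennreal E"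
        unfolding \<xi>_def E_def by (rule nn_integral_exp_norm_fractional_noise_le[OF fbm])
    qed (use p[of n] \<delta>01[of n] q Q \<open>E > 0\<close> \<open>L > 0\<close> growth[of n] in auto)
  qed

  \<comment> \<open>Summability of the weighted moments\<close>
  have "(\<Sum>n. ennreal (w n) * A n) < \<infinity>"
  proof (rule ennreal_summable_recursion)
    \<comment> \<open>Polynomial growth of \<open>\<kappa>\<close> against the decay gained by the
      weights, whose exponent \<open>\<gamma> - 1\<close> is positive.\<close>
    show "(\<lambda>n. C * (2 * a * (real n + 3) powr \<theta>) powr (2 * a) * exp (- l * real n powr (\<gamma> - 1)))
        \<longlonglongrightarrow> 0"
      using \<open>a > 1\<close> \<open>l > 0\<close> \<open>\<gamma> > 1\<close> \<open>\<theta> > 1\<close> \<open>C > 0\<close> by real_asymp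
    show "ennreal (w (Suc n)) * A (Suc n)
        \<le> ennreal (C * (2 * a * (real n + 3) powr \<theta>) powr (2 * a) * exp (- l * real n powr (\<gamma> - 1)))
          * (ennreal (w n) * A n + ennreal (w n) * (\<beta> n + s n + 1))" for n
    proof -
      have "ennreal (w (Suc n)) \<le> ennreal (exp (- l * real n powr (\<gamma> - 1))) * ennreal (w n)"
        using exp_weight_Suc_le[OF \<open>l > 0\<close> \<open>\<gamma> > 1\<close>, of n]
        by (simp add: w_def flip: ennreal_mult)
      then have "ennreal (w (Suc n)) * A (Suc n)
          \<le> ennreal (exp (- l * real n powr (\<gamma> - 1))) * ennreal (w n)
            * (ennreal (\<kappa> n) * (A n + (\<beta> n + s n + 1)))"
        using moment by (intro mult_mono) auto
      also have "\<dots> = ennreal (\<kappa> n * exp (- l * real n powr (\<gamma> - 1)))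
          * (ennreal (w n) * (A n + (\<beta> n + s n + 1)))"
        using \<open>C > 0\<close> by (simp add: \<kappa>_def ennreal_mult mult_ac)
      also have "\<kappa> n * exp (- l * real n powr (\<gamma> - 1)) =
          C * (2 * a * (real n + 3) powr \<theta>) powr (2 * a) * exp (- l * real n powr (\<gamma> - 1))"
        by (simp add: \<kappa>_def)
      finally show ?thesis by (simp only: distrib_left)
    qed
    \<comment> \<open>The empty product gives the exponent \<open>2 * a\<close> at time 0, which is
      the integrability of \<open>x\<close>.\<close>
    show "ennreal (w 0) * A 0 < \<infinity>"
      using x(2) by (simp add: A_def X0 p0 ennreal_mult_less_top)
    \<comment> \<open>The coefficients enter only through their values at the state 0, where
      membership in the weighted space applies.\<close>
    have "(\<Sum>n. ennreal (w n) * \<beta> n) < \<infinity>" "(\<Sum>n. ennreal (w n) * s n) < \<infinity>"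
      using assms(17,18)[of 0] by (simp_all add: weighted_L_def w_def \<beta>_def s_def p_def)
    moreover have "(\<Sum>n. ennreal (w n)) < \<infinity>"
      unfolding w_def by (rule suminf_exp_weight_finite) fact+
    moreover have "(\<Sum>n. ennreal (w n) * (\<beta> n + s n + 1)) =
        (\<Sum>n. ennreal (w n) * \<beta> n) + (\<Sum>n. ennreal (w n) * s n) + (\<Sum>n. ennreal (w n))"
      by (simp add: distrib_left suminf_add[symmetric])
    ultimately show "(\<Sum>n. ennreal (w n) * (\<beta> n + s n + 1)) < \<infinity>" by simp
  qed
  then have X_L: "X \<in> weighted_L M F (2 * a) (delta_theta \<theta>) l \<gamma>"
    using X_F by (simp add: weighted_L_def adapted_process_def w_def A_def p_def)

  \<comment> \<open>Uniqueness\<close>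
  have unique: "AE \<omega> in M. \<forall>n. Y n \<omega> = X n \<omega>" if "sde_solution M x b \<sigma> \<xi> Y" for Y
  proof -
    \<comment> \<open>The countably many almost sure equations share one null set, outside of which
      the paths agree by induction on time.\<close>
    have "AE \<omega> in M. Y 0 \<omega> = X 0 \<omega>"
      "AE \<omega> in M. \<forall>n. Y (Suc n) \<omega> = Y n \<omega> + b n (Y n \<omega>) \<omega> + \<sigma> n (Y n \<omega>) \<omega> *v \<xi> n \<omega>"
      "AE \<omega> in M. \<forall>n. X (Suc n) \<omega> = X n \<omega> + b n (X n \<omega>) \<omega> + \<sigma> n (X n \<omega>) \<omega> *v \<xi> n \<omega>"
      using that X_Suc by (auto simp: sde_solution_def X0 AE_all_countable)
    then show ?thesis
    proof eventually_elim
      case (elim \<omega>)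
      have "Y n \<omega> = X n \<omega>" for n
        by (induction n) (simp_all add: elim)
      then show ?case by blast
    qed
  qed
  have "sde_solution M x b \<sigma> \<xi> X"
    using X_Suc by (simp add: sde_solution_def X0)
  with X_L unique show ?thesis by blast
qed

end
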